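(* Let $\{q_k\}_{k\in\mathbb{N}}$ be a sequence of real numbers with $1<q_k\le 2$ for all $k$ and $q_k\to 1$ as $k\to\infty$. Then the following statements hold. (i) $\ell^1\subset \ell^{q_k}\subset\bigcap_{p>1}\ell^p$, and the latter inclusion is strict. (ii) If $x\in\ell^1$, then $\|x\|_{q_k}\le \sup_k \|x\|_1^{q_k}$. In particular, if $\|x\|_1\le 1$, then $\|x\|_{q_k}\le\|x\|_1$. (iii) The F-norm $\|\cdot\|_{q_k}$ is strictly convex and continuous. (iv) The F-norm $\|\cdot\|_{q_k}$ is Gâteaux differentiable on $\ell^1$, and its derivative at $x$ is given by $\{q_k|x_k|^{q_k-1}\operatorname{sign}(x_k)\}_k$. (v) If additionally $\|x\|_{q_k}\le M$ for some $M>0$, then $\|x\|_2\le\max\{M,1\}$.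
   Context: Sequences $x=\{x_k\}_{k\in\mathbb{N}}$ are real or complex. For a sequence $\{q_k\}_{k\in\mathbb{N}}$ of positive real numbers put $\|x\|_{q_k}:=\sum_k|x_k|^{q_k}$ (no root is taken; the exponent varies with the index $k$; this functional is called the $\ell^{q_k}$ F-norm) and $\ell^{q_k}:=\{x : \sum_k|x_k|^{q_k}<\infty\}$. The space $\ell^{q_k}$ is considered with $d(x,y):=\sum_k|x_k-y_k|^{q_k}$, so that $x^n\to x$ in $\ell^{q_k}$ means $d(x^n,x)\to 0$. For a constant exponent $p\ge1$, $\ell^p$ is the usual sequence space, and $\|x\|_1=\sum_k|x_k|$, $\|x\|_2=(\sum_k|x_k|^2)^{1/2}$ are the usual norms. Here $\operatorname{sign}(t)=t/|t|$ for $t\ne0$ and $\operatorname{sign}(0)=0$. In (iv), a bounded sequence $\{g_k\}$ is identified with the functional $h\mapsto\sum_k g_kh_k$ on $\ell^1$ in the real case, and with the real-linear functional $h\mapsto\operatorname{Re}\sum_k g_k\overline{h_k}$ in the complex case. *)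

theory Defs
  imports "HOL-Analysis.Analysis"
begin

text \<open>
  Sequences take values in a real normed space \<open>'a\<close>, instantiated with \<^typ>\<open>real\<close> and
  \<^typ>\<open>complex\<close>. A constant exponent \<open>p\<close> is the exponent sequence \<open>\<lambda>_. p\<close>, so the usual
  space of \<open>p\<close>-summable sequences is \<open>ell (\<lambda>_. p)\<close>.
\<close>

definition ell :: "(nat \<Rightarrow> real) \<Rightarrow> (nat \<Rightarrow> 'a::real_normed_vector) set" where
  "ell q = {x. summable (\<lambda>k. norm (x k) powr q k)}"

text \<open>
  \<open>fnorm q\<close>, \<open>l1_norm\<close> and \<open>l2_norm\<close> are defined by real-valued series and are meaningful only on
  \<open>ell q\<close>, \<open>ell (\<lambda>_. 1)\<close> and \<open>ell (\<lambda>_. 2)\<close>, respectively.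
\<close>

definition fnorm :: "(nat \<Rightarrow> real) \<Rightarrow> (nat \<Rightarrow> 'a::real_normed_vector) \<Rightarrow> real" where
  "fnorm q x = (\<Sum>k. norm (x k) powr q k)"

definition ell_dist ::
    "(nat \<Rightarrow> real) \<Rightarrow> (nat \<Rightarrow> 'a::real_normed_vector) \<Rightarrow> (nat \<Rightarrow> 'a) \<Rightarrow> real" where
  "ell_dist q x y = (\<Sum>k. norm (x k - y k) powr q k)"

definition l1_norm :: "(nat \<Rightarrow> 'a::real_normed_vector) \<Rightarrow> real" where
  "l1_norm x = (\<Sum>k. norm (x k))"

definition l2_norm :: "(nat \<Rightarrow> 'a::real_normed_vector) \<Rightarrow> real" where
  "l2_norm x = sqrt (\<Sum>k. (norm (x k))\<^sup>2)"

text \<open>Closure of \<open>S\<close> under convex combinations is part of strict convexity on \<open>S\<close>.\<close>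

definition strictly_convex_on ::
    "(nat \<Rightarrow> 'a::real_vector) set \<Rightarrow> ((nat \<Rightarrow> 'a) \<Rightarrow> real) \<Rightarrow> bool" where
  "strictly_convex_on S F \<longleftrightarrow>
    (\<forall>x\<in>S. \<forall>y\<in>S. \<forall>t. 0 < t \<and> t < 1 \<longrightarrow>
       (\<lambda>k. (1 - t) *\<^sub>R x k + t *\<^sub>R y k) \<in> S \<and>
       (x \<noteq> y \<longrightarrow> F (\<lambda>k. (1 - t) *\<^sub>R x k + t *\<^sub>R y k) < (1 - t) * F x + t * F y))"

text \<open>
  Continuity is with respect to the convergence \<open>X n \<longrightarrow> x\<close> given by \<open>ell_dist q (X n) x \<longrightarrow> 0\<close>;
  \<open>ell_dist q\<close> need not satisfy the triangle inequality when exponents exceed 1, hence no metric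
  space structure is used.
\<close>

definition ell_continuous ::
    "(nat \<Rightarrow> real) \<Rightarrow> ((nat \<Rightarrow> 'a::real_normed_vector) \<Rightarrow> real) \<Rightarrow> bool" where
  "ell_continuous q F \<longleftrightarrow>
    (\<forall>X x. (\<forall>n. X n \<in> ell q) \<and> x \<in> ell q \<and> (\<lambda>n. ell_dist q (X n) x) \<longlonglongrightarrow> 0
       \<longrightarrow> (\<lambda>n. F (X n)) \<longlonglongrightarrow> F x)"

definition l1_bounded_linear :: "((nat \<Rightarrow> 'a::real_normed_vector) \<Rightarrow> real) \<Rightarrow> bool" where
  "l1_bounded_linear L \<longleftrightarrow>
    (\<forall>h\<in>ell (\<lambda>_. 1). \<forall>h'\<in>ell (\<lambda>_. 1). L (\<lambda>k. h k + h' k) = L h + L h') \<and>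
    (\<forall>h\<in>ell (\<lambda>_. 1). \<forall>c. L (\<lambda>k. c *\<^sub>R h k) = c * L h) \<and>
    (\<exists>C. \<forall>h\<in>ell (\<lambda>_. 1). \<bar>L h\<bar> \<le> C * l1_norm h)"

definition has_gateaux_derivative_l1 ::
    "((nat \<Rightarrow> 'a::real_normed_vector) \<Rightarrow> real) \<Rightarrow> ((nat \<Rightarrow> 'a) \<Rightarrow> real) \<Rightarrow> (nat \<Rightarrow> 'a) \<Rightarrow> bool" where
  "has_gateaux_derivative_l1 F L x \<longleftrightarrow>
    l1_bounded_linear L \<and>
    (\<forall>h\<in>ell (\<lambda>_. 1). ((\<lambda>t::real. (F (\<lambda>k. x k + t *\<^sub>R h k) - F x) / t) \<longlongrightarrow> L h) (at 0))"

definition fnorm_gradient ::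
    "(nat \<Rightarrow> real) \<Rightarrow> (nat \<Rightarrow> 'a::real_normed_vector) \<Rightarrow> nat \<Rightarrow> 'a" where
  "fnorm_gradient q x = (\<lambda>k. (q k * norm (x k) powr (q k - 1)) *\<^sub>R sgn (x k))"

text \<open>The functionals on \<open>ell (\<lambda>_. 1)\<close> with which a bounded sequence \<open>g\<close> is identified.\<close>

definition real_functional :: "(nat \<Rightarrow> real) \<Rightarrow> (nat \<Rightarrow> real) \<Rightarrow> real" where
  "real_functional g h = (\<Sum>k. g k * h k)"

definition complex_functional :: "(nat \<Rightarrow> complex) \<Rightarrow> (nat \<Rightarrow> complex) \<Rightarrow> real" where
  "complex_functional g h = Re (\<Sum>k. g k * cnj (h k))"

end

theory Submission
  imports Defs
begin

text \<open>
  Strict convexity is termwise: if \<open>norm x = norm y\<close>, the norm of an inner product space is strictly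
  convex between \<open>x\<close> and \<open>y\<close>, and otherwise the scalar power is, by its tangent inequality.
  Continuity does not need a triangle inequality for the distance: convexity and \<open>q k \<le> 2\<close> give
  \<open>fnorm q (u + v) \<le> fnorm q u / (1 - t) + fnorm q v / t\<close> for all \<open>0 < t < 1\<close>, and one lets
  \<open>t\<close> tend to 0 more slowly than the distance. For the derivative, the difference quotients of the
  terms are dominated by a multiple of \<open>norm (h k)\<close>, so Tannery's theorem applies. In (v), dividing \<open>x\<close>
  by \<open>max M 1\<close> brings its F-norm below 1, where the F-norm dominates the squared 2-norm.
\<close>

section \<open>Tangent and convexity inequalities for powers of numbers and norms\<close>

text \<open>For \<open>v > 0\<close> write \<open>v powr q\<close> as
  \<open>v * exp ((q - 1) * ln v)\<close> and use \<open>exp s \<ge> 1 + s\<close>. Strictness comes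
  from \<open>v - 1 < v * ln v\<close>, which is the logarithm inequality at
  \<open>1 / v\<close>.\<close>

lemma powr_Bernoulli_strict:
  fixes v q :: real
  assumes "1 < q" "0 \<le> v" "v \<noteq> 1"
  shows "1 + q * (v - 1) < v powr q"
proof (cases "v = 0")
  case True
  then show ?thesis using assms by simp
next
  case False
  then have v: "0 < v" using assms by simp
  have "ln (1 / v) < 1 / v - 1"
    using ln_le_minus_one[of "1 / v"] ln_eq_minus_one[of "1 / v"] v assms(3) by force
  then have "v - 1 < v * ln v"
    using v by (simp add: ln_div field_simps)
  then have "(q - 1) * (v - 1) < (q - 1) * (v * ln v)"
    using assms(1) by simp
  also have "v + \<dots> = v * (1 + (q - 1) * ln v)"
    by (simp add: algebra_simps)
  also have "\<dots> \<le> v * exp ((q - 1) * ln v)"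
    using v by (intro mult_left_mono) (auto simp del: exp_ln)
  also have "\<dots> = v powr q"
    using v powr_add[of v 1 "q - 1"] by (simp add: powr_def)
  finally show ?thesis by (simp add: algebra_simps)
qed

text \<open>Rescaling by \<open>m\<close> moves the tangent point to 1, where this is the Bernoulli
  inequality for \<open>v = u / m\<close>.\<close>

lemma powr_tangent_strict:
  fixes m u q :: real
  assumes "1 < q" "0 < m" "0 \<le> u" "u \<noteq> m"
  shows "m powr q + q * m powr (q - 1) * (u - m) < u powr q"
proof -
  have "m powr q * (1 + q * (u / m - 1)) < m powr q * (u / m) powr q"
    using assms by (intro mult_strict_left_mono powr_Bernoulli_strict) auto
  also have "\<dots> = u powr q"
    using assms by (simp add: powr_divide)
  finally show ?thesis
    using assms by (simp add: powr_diff field_simps)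
qed

lemma powr_tangent:
  fixes m u q :: real
  assumes "1 < q" "0 \<le> m" "0 \<le> u"
  shows "m powr q + q * m powr (q - 1) * (u - m) \<le> u powr q"
  using powr_tangent_strict[of q m u] assms by (cases "m = 0"; cases "u = m") auto

lemma powr_strictly_convex:
  fixes a b q t :: real
  assumes "1 < q" "0 \<le> a" "0 \<le> b" "a \<noteq> b" "0 < t" "t < 1"
  shows "((1 - t) * a + t * b) powr q < (1 - t) * a powr q + t * b powr q"
proof -
  define m where "m = (1 - t) * a + t * b"
  define c where "c = q * m powr (q - 1)"
  have "0 < (1 - t) * a \<or> 0 < t * b"
    using assms by (cases "a = 0") auto
  then have m: "0 < m"
    unfolding m_def using assms by (meson add_nonneg_pos add_pos_nonneg diff_ge_0_iff_ge less_imp_le mult_nonneg_nonneg)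
  have am: "a - m = t * (a - b)" and bm: "b - m = (1 - t) * (b - a)"
    by (auto simp: m_def algebra_simps)
  then have "a \<noteq> m" "b \<noteq> m"
    using assms by auto
  then have "m powr q + c * (a - m) < a powr q" "m powr q + c * (b - m) < b powr q"
    unfolding c_def using assms m by (auto intro: powr_tangent_strict)
  \<comment> \<open>In the weighted sum of the two tangent inequalities at the mean
    \<open>m\<close>, the linear terms cancel.\<close>
  then have "(1 - t) * (m powr q + c * (a - m)) + t * (m powr q + c * (b - m))
      < (1 - t) * a powr q + t * b powr q"
    using assms by (intro add_strict_mono mult_strict_left_mono) auto
  moreover have "(1 - t) * (m powr q + c * (a - m)) + t * (m powr q + c * (b - m)) = m powr q"
    unfolding am bm by (simp add: algebra_simps)
  ultimately show ?thesis
    by (simp add: m_def)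
qed

text \<open>Triangle inequality followed by convexity of the scalar power. This form holds in every
  normed space; the strict one below uses an inner product.\<close>

lemma norm_powr_convex:
  fixes x y :: "'a::real_normed_vector"
  assumes "1 < q" "0 < t" "t < 1"
  shows "norm ((1 - t) *\<^sub>R x + t *\<^sub>R y) powr q \<le> (1 - t) * norm x powr q + t * norm y powr q"
proof -
  have "norm ((1 - t) *\<^sub>R x + t *\<^sub>R y) powr q \<le> ((1 - t) * norm x + t * norm y) powr q"
    using norm_triangle_ineq[of "(1 - t) *\<^sub>R x" "t *\<^sub>R y"] assms by (intro powr_mono2) auto
  also have "\<dots> \<le> (1 - t) * norm x powr q + t * norm y powr q"
  proof (cases "norm x = norm y")
    case True
    then show ?thesis by (simp flip: distrib_right)
  next
    case False
    then show ?thesis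
      using powr_strictly_convex[of q "norm x" "norm y" t] assms by simp
  qed
  finally show ?thesis .
qed

lemma norm_powr_strictly_convex:
  fixes x y :: "'a::real_inner"
  assumes "1 < q" "0 < t" "t < 1" "x \<noteq> y"
  shows "norm ((1 - t) *\<^sub>R x + t *\<^sub>R y) powr q < (1 - t) * norm x powr q + t * norm y powr q"
proof (cases "norm x = norm y")
  case False
  have "norm ((1 - t) *\<^sub>R x + t *\<^sub>R y) powr q \<le> ((1 - t) * norm x + t * norm y) powr q"
    using norm_triangle_ineq[of "(1 - t) *\<^sub>R x" "t *\<^sub>R y"] assms by (intro powr_mono2) auto
  also have "\<dots> < (1 - t) * norm x powr q + t * norm y powr q"
    using False assms by (intro powr_strictly_convex) auto
  finally show ?thesis .
next
  case True
  then have "norm x \<noteq> 0"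
    using assms(4) by auto
  \<comment> \<open>Equality in the triangle inequality would make the two vectors nonnegative
    multiples of each other, and with equal nonzero norms this forces \<open>x = y\<close>.\<close>
  then have "norm ((1 - t) *\<^sub>R x + t *\<^sub>R y) \<noteq> norm ((1 - t) *\<^sub>R x) + norm (t *\<^sub>R y)"
    unfolding norm_triangle_eq using assms True by (auto simp: mult_ac)
  then have "norm ((1 - t) *\<^sub>R x + t *\<^sub>R y) < norm ((1 - t) *\<^sub>R x) + norm (t *\<^sub>R y)"
    using norm_triangle_ineq[of "(1 - t) *\<^sub>R x" "t *\<^sub>R y"] by linarith
  also have "\<dots> = norm x"
    using assms True by (simp flip: distrib_right)
  finally have "norm ((1 - t) *\<^sub>R x + t *\<^sub>R y) powr q < norm x powr q"
    using assms by (intro powr_less_mono2) auto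
  then show ?thesis
    using True by (simp flip: distrib_right)
qed

text \<open>The sum \<open>u + v\<close> is the convex combination of \<open>u / (1 - t)\<close> and
  \<open>v / t\<close>. Scaling by \<open>1 / s\<close> costs at most the factor
  \<open>(1 / s)\<^sup>2\<close> because \<open>q \<le> 2\<close>, and the weight \<open>s\<close>
  cancels one of the two powers.\<close>

lemma norm_add_powr_le:
  fixes u v :: "'a::real_normed_vector"
  assumes "1 < q" "q \<le> 2" "0 < t" "t < 1"
  shows "norm (u + v) powr q \<le> norm u powr q / (1 - t) + norm v powr q / t"
proof -
  have scale: "s * norm ((1 / s) *\<^sub>R w) powr q \<le> norm w powr q / s" if "0 < s" "s < 1" for s and w :: 'a
  proof -
    have "(1 / s) powr q \<le> (1 / s) powr 2"
      using that assms by (intro powr_mono) auto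
    then have "s * ((1 / s) powr q * norm w powr q) \<le> s * ((1 / s) powr 2 * norm w powr q)"
      using that by (intro mult_left_mono mult_right_mono) auto
    also have "\<dots> = norm w powr q / s"
      using that by (simp add: powr_numeral power2_eq_square)
    finally show ?thesis
      using that by (simp add: powr_mult powr_divide)
  qed
  have "norm (u + v) powr q
      = norm ((1 - t) *\<^sub>R ((1 / (1 - t)) *\<^sub>R u) + t *\<^sub>R ((1 / t) *\<^sub>R v)) powr q"
    using assms by simp
  also have "\<dots> \<le> (1 - t) * norm ((1 / (1 - t)) *\<^sub>R u) powr q + t * norm ((1 / t) *\<^sub>R v) powr q"
    using assms by (intro norm_powr_convex)
  also have "\<dots> \<le> norm u powr q / (1 - t) + norm v powr q / t"
    using assms by (intro add_mono scale) auto
  finally show ?thesis .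
qed

lemma mult_powr_minus_one_le:
  fixes a R q :: real
  assumes "1 < q" "q \<le> 2" "0 \<le> a" "a \<le> R" "1 \<le> R"
  shows "q * a powr (q - 1) \<le> 2 * R"
proof -
  have "a powr (q - 1) \<le> R powr (q - 1)"
    using assms by (intro powr_mono2) auto
  also have "\<dots> \<le> R"
    using assms powr_mono[of "q - 1" 1 R] by simp
  finally show ?thesis
    using assms by (intro mult_mono) auto
qed

text \<open>The tangent inequality, used from both sides, bounds the difference by the slope at the
  larger argument. The Lipschitz constant \<open>2 * R\<close> is the same for all exponents in the
  range, so one constant serves all indices of a sequence.\<close>

lemma abs_powr_diff_le:
  fixes a b R q :: real
  assumes "1 < q" "q \<le> 2" "0 \<le> a" "0 \<le> b" "a \<le> R" "b \<le> R" "1 \<le> R"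
  shows "\<bar>a powr q - b powr q\<bar> \<le> 2 * R * \<bar>a - b\<bar>"
proof -
  have *: "u powr q - v powr q \<le> 2 * R * \<bar>u - v\<bar>"
    if "0 \<le> u" "0 \<le> v" "u \<le> R" for u v
  proof -
    have "u powr q - v powr q \<le> q * u powr (q - 1) * (u - v)"
      using powr_tangent[of q u v] that assms by (simp add: algebra_simps)
    also have "\<dots> \<le> q * u powr (q - 1) * \<bar>u - v\<bar>"
      using assms that by (intro mult_left_mono) auto
    also have "\<dots> \<le> 2 * R * \<bar>u - v\<bar>"
      using assms that by (intro mult_right_mono mult_powr_minus_one_le) auto
    finally show ?thesis .
  qed
  show ?thesis
    using *[of a b] *[of b a] assms by (simp add: abs_le_iff abs_minus_commute)
qed

text \<open>Away from 0 this is the chain rule for the norm. At \<open>a = 0\<close> the quotient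
  has absolute value \<open>norm b powr q * \<bar>t\<bar> powr (q - 1)\<close>, which tends to 0
  because \<open>q > 1\<close>; this agrees with \<open>sgn 0 = 0\<close>.\<close>

lemma norm_powr_line_deriv:
  fixes a b :: "'a::real_inner"
  assumes "1 < q"
  shows "((\<lambda>t. (norm (a + t *\<^sub>R b) powr q - norm a powr q) / t)
      \<longlongrightarrow> inner ((q * norm a powr (q - 1)) *\<^sub>R sgn a) b) (at (0::real))"
proof (cases "a = 0")
  case True
  have "((\<lambda>t::real. \<bar>t\<bar> powr (q - 1)) \<longlongrightarrow> 0) (at 0)"
    using assms by (auto intro!: tendsto_eq_intros)
  then have "((\<lambda>t::real. norm b powr q * \<bar>t\<bar> powr (q - 1)) \<longlongrightarrow> 0) (at 0)"
    by (rule tendsto_mult_right_zero)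
  then have "((\<lambda>t. (norm (t *\<^sub>R b) powr q) / t) \<longlongrightarrow> 0) (at (0::real))"
    by (rule Lim_null_comparison[rotated])
       (auto simp: eventually_at_filter powr_mult powr_diff mult.commute)
  then show ?thesis
    using True by simp
next
  case False
  have "((\<lambda>t. norm (a + t *\<^sub>R b)) has_derivative (\<lambda>t. inner (t *\<^sub>R b) (sgn a))) (at (0::real))"
    by (rule has_derivative_compose[where f="\<lambda>t. a + t *\<^sub>R b" and f'="\<lambda>t. t *\<^sub>R b"])
       (use False in \<open>auto intro!: derivative_eq_intros has_derivative_norm\<close>)
  then have "DERIV (\<lambda>t. norm (a + t *\<^sub>R b)) 0 :> inner b (sgn a)"
    by (simp add: has_field_derivative_def mult_commute_abs)
  from DERIV_fun_powr[OF this, of q] False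
  have "DERIV (\<lambda>t. norm (a + t *\<^sub>R b) powr q) 0 :> q * norm a powr (q - 1) * inner b (sgn a)"
    by simp
  then show ?thesis
    by (simp add: DERIV_def inner_commute)
qed

section \<open>Inclusions between the sequence spaces\<close>

lemma ell_1_iff: "x \<in> ell (\<lambda>_. 1) \<longleftrightarrow> summable (\<lambda>k. norm (x k))"
  by (simp add: ell_def)

lemma ell_eventually_norm_le_1:
  assumes "x \<in> ell q" "\<And>k. 0 \<le> q k"
  shows "eventually (\<lambda>k. norm (x k) \<le> 1) sequentially"
proof -
  have "(\<lambda>k. norm (x k) powr q k) \<longlonglongrightarrow> 0"
    using assms(1) by (auto simp: ell_def intro: summable_LIMSEQ_zero)
  then have "eventually (\<lambda>k. norm (x k) powr q k < 1) sequentially"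
    by (rule order_tendstoD) simp
  then show ?thesis
  proof eventually_elim
    case (elim k)
    then show ?case
      using ge_one_powr_ge_zero[of "norm (x k)" "q k"] assms(2)[of k] by linarith
  qed
qed

text \<open>The terms of a convergent series are eventually at most 1, and on the unit interval a
  larger exponent gives a smaller power.\<close>

lemma ell_mono_eventually:
  assumes x: "x \<in> ell p" and p: "\<And>k. 0 \<le> p k"
    and le: "eventually (\<lambda>k. p k \<le> r k) sequentially"
  shows "x \<in> ell r"
  unfolding ell_def mem_Collect_eq
proof (rule summable_comparison_test_ev)
  show "eventually (\<lambda>k. norm (norm (x k) powr r k) \<le> norm (x k) powr p k) sequentially"
    using le ell_eventually_norm_le_1[OF x p] by eventually_elim (auto intro: powr_mono')
  show "summable (\<lambda>k. norm (x k) powr p k)"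
    using x by (simp add: ell_def)
qed

lemma ell_1_subset_ell:
  assumes "\<And>k. 1 < q k"
  shows "ell (\<lambda>_. 1) \<subseteq> ell q"
proof
  fix x :: "nat \<Rightarrow> 'a"
  assume "x \<in> ell (\<lambda>_. 1)"
  then show "x \<in> ell q"
    by (rule ell_mono_eventually) (use assms in \<open>simp_all add: less_imp_le\<close>)
qed

lemma ell_subset_ell_const:
  assumes "\<And>k. 1 < q k" "q \<longlonglongrightarrow> 1" "1 < p"
  shows "ell q \<subseteq> ell (\<lambda>_. p)"
proof
  fix x :: "nat \<Rightarrow> 'a"
  assume "x \<in> ell q"
  moreover have "0 \<le> q k" for k
    using assms(1)[of k] by simp
  moreover have "eventually (\<lambda>k. q k \<le> p) sequentially"
    using order_tendstoD(2)[OF assms(2,3)] by eventually_elim simp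
  ultimately show "x \<in> ell (\<lambda>_. p)"
    by (rule ell_mono_eventually[where p=q and r="\<lambda>_. p"])
qed

lemma sparse_subsequence:
  fixes q :: "nat \<Rightarrow> real"
  assumes "q \<longlonglongrightarrow> L" "\<And>m. 0 < \<epsilon> m"
  obtains r :: "nat \<Rightarrow> nat" where "strict_mono r" "\<And>m. q (r m) < L + \<epsilon> m"
proof -
  have ev: "\<exists>k>n. q k < L + \<epsilon> m" for n m
  proof -
    have "eventually (\<lambda>k. n < k \<and> q k < L + \<epsilon> m) sequentially"
      using assms(2)[of m] by (intro eventually_conj eventually_gt_at_top order_tendstoD(2)[OF assms(1)]) simp
    then show ?thesis
      using eventually_happens'[OF sequentially_bot] by blast
  qed
  have "\<exists>r. \<forall>m. q (r m) < L + \<epsilon> m \<and> r m < r (Suc m)"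
    by (rule dependent_nat_choice) (use ev in blast)+
  then show ?thesis
    using that by (auto simp: strict_mono_Suc_iff)
qed

lemma ell_strict_subset:
  fixes e :: "'a::real_normed_vector"
  assumes "\<And>k. 1 < q k" "q \<longlonglongrightarrow> 1" "norm e = 1"
  shows "(ell q :: (nat \<Rightarrow> 'a) set) \<subset> (\<Inter>p\<in>{1<..}. ell (\<lambda>_. p))"
proof -
  \<comment> \<open>Put \<open>1 / (m + 2)\<close> at a sparse position \<open>r m\<close> with \<open>q (r m) < 1 + 1 / ln (m + 2)\<close>: raising it to
    the power \<open>q (r m)\<close> costs at most a factor \<open>e\<close> against the harmonic series.\<close>
  define a where "a m = inverse (real (m + 2))" for m
  have a: "0 < a m" "a m \<le> 1" for m
    by (auto simp: a_def field_simps)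
  have "0 < 1 / ln (real (m + 2))" for m
    by simp
  then obtain r :: "nat \<Rightarrow> nat"
    where r: "strict_mono r" and qr: "\<And>m. q (r m) < 1 + 1 / ln (real (m + 2))"
    by (rule sparse_subsequence[OF assms(2), where \<epsilon>="\<lambda>m. 1 / ln (real (m + 2))"]) blast
  define x where "x k = (if k \<in> range r then a (inv r k) *\<^sub>R e else 0)" for k
  have "inj r"
    using r by (rule strict_mono_imp_inj_on)
  then have norm_x: "norm (x (r m)) = a m" for m
    using a(1)[of m] assms(3) by (simp add: x_def)
  \<comment> \<open>Off the range of \<open>r\<close> the sequence vanishes, so summability may be
    tested along \<open>r\<close> alone.\<close>
  have x_ell: "x \<in> ell s \<longleftrightarrow> summable (\<lambda>m. a m powr s (r m))" for s
    using summable_mono_reindex[OF r, of "\<lambda>k. norm (x k) powr s k"]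
    by (simp add: ell_def norm_x) (simp add: x_def)
  have "x \<in> ell (\<lambda>_. p)" if "1 < p" for p
  proof -
    have "summable (\<lambda>m. real (m + 2) powr - p)"
      using that summable_iff_shift[of "\<lambda>n. real n powr - p" 2] summable_real_powr_iff[of "- p"] by simp
    then show ?thesis
      by (simp add: x_ell a_def powr_minus inverse_powr)
  qed
  moreover have "x \<notin> ell q"
  proof
    assume "x \<in> ell q"
    then have "summable (\<lambda>m. exp 1 * a m powr q (r m))"
      by (simp add: x_ell summable_mult)
    then have "summable a"
    proof (rule summable_comparison_test')
      fix m :: nat
      have "0 < ln (real (m + 2))"
        by simp
      then have "(q (r m) - 1) * ln (real (m + 2)) \<le> 1"
        using qr[of m] by (simp add: field_simps)
      then have "exp ((q (r m) - 1) * ln (a m)) \<ge> exp (- 1)"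
        unfolding a_def by (simp add: ln_inverse)
      then have "exp (- 1) * a m \<le> a m powr (q (r m) - 1) * a m"
        using a(1)[of m] by (intro mult_right_mono) (auto simp: powr_def)
      also have "\<dots> = a m powr q (r m)"
        using a(1)[of m] by (simp add: powr_diff)
      finally show "norm (a m) \<le> exp 1 * a m powr q (r m)"
        using a(1)[of m] by (simp add: exp_minus field_simps)
    qed
    then have "summable (\<lambda>n. inverse (real n))"
      unfolding a_def by (rule summable_iff_shift[of "\<lambda>n. inverse (real n)" 2, THEN iffD1])
    then show False
      using not_summable_harmonic by blast
  qed
  ultimately have "x \<in> (\<Inter>p\<in>{1<..}. ell (\<lambda>_. p)) - ell q"
    by simp
  then show ?thesis
    using ell_subset_ell_const[OF assms(1,2), where 'a='a] by blast
qed

section \<open>Comparison with the 1-norm\<close>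

lemma norm_le_l1_norm:
  assumes "x \<in> ell (\<lambda>_. 1)"
  shows "norm (x k) \<le> l1_norm x"
  using sum_le_suminf[of "\<lambda>k. norm (x k)" "{k}"] assms by (simp add: ell_1_iff l1_norm_def)

text \<open>Boundedness makes the real-valued \<open>SUP\<close> an actual upper bound. Replacing
  \<open>s\<close> by \<open>max 1 s\<close> makes the power increase with the exponent.\<close>

lemma bdd_above_powr_exponent_le_2:
  fixes s :: real
  assumes "\<And>k. 1 < q k" "\<And>k. q k \<le> 2" "0 \<le> s"
  shows "bdd_above (range (\<lambda>k. s powr q k))"
proof (rule bdd_aboveI2)
  fix k
  have "s powr q k \<le> max 1 s powr q k"
    using assms(1)[of k] assms(3) by (intro powr_mono2) auto
  also have "\<dots> \<le> max 1 s powr 2"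
    using assms(2)[of k] by (intro powr_mono) auto
  finally show "s powr q k \<le> max 1 s powr 2" .
qed

text \<open>Normalize by \<open>s = l1_norm x\<close>: the ratio \<open>norm (x k) / s\<close> is at
  most 1, so raising it to \<open>q k\<close> does not increase it, and the factor
  \<open>s powr q k\<close> is at most the supremum. Summing the ratios gives 1.\<close>

lemma fnorm_le_SUP:
  assumes q: "\<And>k. 1 < q k" "\<And>k. q k \<le> 2" and x: "x \<in> ell (\<lambda>_. 1)"
  shows "fnorm q x \<le> (SUP k. l1_norm x powr q k)"
proof (cases "l1_norm x = 0")
  case True
  then have "norm (x k) = 0" for k
    using norm_le_l1_norm[OF x, of k] by simp
  then show ?thesis
    using True by (simp add: fnorm_def)
next
  case False
  define s where "s = l1_norm x"
  define S where "S = (SUP k. s powr q k)"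
  have sum_x: "summable (\<lambda>k. norm (x k))"
    using x by (simp add: ell_1_iff)
  have s: "0 < s"
    using False suminf_nonneg[OF sum_x] by (simp add: s_def l1_norm_def)
  have S: "s powr q k \<le> S" for k
    unfolding S_def using q s by (intro cSUP_upper bdd_above_powr_exponent_le_2) auto
  have le: "norm (x k) powr q k \<le> S / s * norm (x k)" for k
  proof -
    have "norm (x k) powr q k = s powr q k * (norm (x k) / s) powr q k"
      using s by (simp add: powr_divide)
    also have "\<dots> \<le> S * (norm (x k) / s) powr 1"
      using s S[of k] norm_le_l1_norm[OF x, of k] q(1)[of k] order_trans[OF powr_ge_zero S[of k]]
      by (intro mult_mono powr_mono') (auto simp: s_def)
    finally show ?thesis
      using s by simp
  qed
  have "fnorm q x \<le> (\<Sum>k. S / s * norm (x k))"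
    unfolding fnorm_def using le ell_1_subset_ell[where q=q, OF q(1)] x sum_x
    by (intro suminf_le summable_mult) (auto simp: ell_def)
  also have "\<dots> = S / s * s"
    unfolding s_def l1_norm_def by (rule suminf_mult[OF sum_x])
  finally show ?thesis
    using s by (simp add: S_def s_def)
qed

lemma fnorm_le_l1_norm:
  assumes q: "\<And>k. 1 < q k" "\<And>k. q k \<le> 2" and x: "x \<in> ell (\<lambda>_. 1)" and le: "l1_norm x \<le> 1"
  shows "fnorm q x \<le> l1_norm x"
proof -
  have nonneg: "0 \<le> l1_norm x"
    using x by (simp add: l1_norm_def ell_1_iff suminf_nonneg)
  have "l1_norm x powr q k \<le> l1_norm x" for k
    using powr_mono'[of 1 "q k" "l1_norm x"] nonneg le q(1)[of k] by simp
  then have "(SUP k. l1_norm x powr q k) \<le> l1_norm x"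
    by (intro cSUP_least) auto
  then show ?thesis
    using fnorm_le_SUP[where q=q, OF q x] by linarith
qed

section \<open>Strict convexity and continuity of the F-norm\<close>

lemma fnorm_strictly_convex:
  assumes q: "\<And>k. 1 < q k"
  shows "strictly_convex_on (ell q) (fnorm q :: (nat \<Rightarrow> 'a::real_inner) \<Rightarrow> real)"
  unfolding strictly_convex_on_def
proof (intro ballI allI impI)
  fix x y :: "nat \<Rightarrow> 'a" and t :: real
  assume x: "x \<in> ell q" and y: "y \<in> ell q" and "0 < t \<and> t < 1"
  then have t: "0 < t" "t < 1"
    by auto
  let ?z = "\<lambda>k. (1 - t) *\<^sub>R x k + t *\<^sub>R y k"
  let ?g = "\<lambda>k. (1 - t) * norm (x k) powr q k + t * norm (y k) powr q k"
  have sx: "summable (\<lambda>k. norm (x k) powr q k)" and sy: "summable (\<lambda>k. norm (y k) powr q k)"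
    using x y by (auto simp: ell_def)
  then have sg: "summable ?g"
    by (intro summable_add summable_mult)
  have le: "norm (?z k) powr q k \<le> ?g k" for k
    using norm_powr_convex[OF q t] .
  have sz: "summable (\<lambda>k. norm (?z k) powr q k)"
    using le by (intro summable_comparison_test'[OF sg]) auto
  then have "?z \<in> ell q"
    by (simp add: ell_def)
  moreover have "fnorm q ?z < (1 - t) * fnorm q x + t * fnorm q y" if neq: "x \<noteq> y"
  proof -
    obtain i where "x i \<noteq> y i"
      using neq by (auto simp: fun_eq_iff)
    then have "norm (?z i) powr q i < ?g i"
      using norm_powr_strictly_convex[OF q t] by blast
    \<comment> \<open>One strict term suffices: all gaps are nonnegative and the gap at
      \<open>i\<close> is positive.\<close>
    then have "0 < (\<Sum>k. ?g k - norm (?z k) powr q k)"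
      using le by (intro suminf_pos2[where i=i] summable_diff sg sz) auto
    also have "\<dots> = (\<Sum>k. ?g k) - fnorm q ?z"
      using suminf_diff[OF sg sz] by (simp add: fnorm_def)
    also have "(\<Sum>k. ?g k) = (1 - t) * fnorm q x + t * fnorm q y"
      unfolding fnorm_def using sx sy
      by (simp add: suminf_add[symmetric] suminf_mult summable_mult)
    finally show ?thesis
      by simp
  qed
  ultimately show "?z \<in> ell q \<and> (x \<noteq> y \<longrightarrow> fnorm q ?z < (1 - t) * fnorm q x + t * fnorm q y)"
    by blast
qed

lemma ell_add:
  assumes q: "\<And>k. 1 < q k" "\<And>k. q k \<le> 2" and "u \<in> ell q" "v \<in> ell q" and t: "0 < t" "t < 1"
  shows "(\<lambda>k. u k + v k) \<in> ell q"
    and "fnorm q (\<lambda>k. u k + v k) \<le> fnorm q u / (1 - t) + fnorm q v / t"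
proof -
  let ?b = "\<lambda>k. norm (u k) powr q k / (1 - t) + norm (v k) powr q k / t"
  have s: "summable (\<lambda>k. norm (u k) powr q k)" "summable (\<lambda>k. norm (v k) powr q k)"
    using assms by (auto simp: ell_def)
  then have sb: "summable ?b"
    by (intro summable_add summable_divide)
  have le: "norm (u k + v k) powr q k \<le> ?b k" for k
    using norm_add_powr_le[OF q t] .
  have *: "summable (\<lambda>k. norm (u k + v k) powr q k)"
    using le by (intro summable_comparison_test'[OF sb]) auto
  then show "(\<lambda>k. u k + v k) \<in> ell q"
    by (simp add: ell_def)
  have "fnorm q (\<lambda>k. u k + v k) \<le> (\<Sum>k. ?b k)"
    unfolding fnorm_def by (rule suminf_le[OF le * sb])
  also have "\<dots> = fnorm q u / (1 - t) + fnorm q v / t"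
    unfolding fnorm_def using s by (simp add: suminf_add[symmetric] suminf_divide summable_divide)
  finally show "fnorm q (\<lambda>k. u k + v k) \<le> fnorm q u / (1 - t) + fnorm q v / t" .
qed

lemma ell_uminus: "v \<in> ell q \<Longrightarrow> (\<lambda>k. - v k) \<in> ell q"
  by (simp add: ell_def)

lemma fnorm_continuous:
  assumes q: "\<And>k. 1 < q k" "\<And>k. q k \<le> 2"
  shows "ell_continuous q (fnorm q)"
  unfolding ell_continuous_def
proof (intro allI impI, elim conjE)
  fix X :: "nat \<Rightarrow> nat \<Rightarrow> 'a" and x
  assume X: "\<forall>n. X n \<in> ell q" and x: "x \<in> ell q" and lim: "(\<lambda>n. ell_dist q (X n) x) \<longlonglongrightarrow> 0"
  define d where "d n = ell_dist q (X n) x" for n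
  \<comment> \<open>The weights must satisfy both \<open>t n \<longlonglongrightarrow> 0\<close> and \<open>d n / t n \<longlonglongrightarrow> 0\<close>;
    the second summand keeps them positive when \<open>d n = 0\<close>.\<close>
  define t where "t n = sqrt (d n) + 1 / real (n + 2)" for n
  \<comment> \<open>Membership of the difference makes the series behind \<open>ell_dist\<close>
    converge. No estimate is drawn from it, so the weight \<open>1/2\<close> is arbitrary.\<close>
  have diff: "(\<lambda>k. X n k - x k) \<in> ell q" for n
    using ell_add(1)[where u="X n" and v="\<lambda>k. - x k" and t="1/2", OF q] X x by (simp add: ell_uminus)
  have d_eq: "d n = fnorm q (\<lambda>k. X n k - x k)" "d n = fnorm q (\<lambda>k. x k - X n k)" for n
    by (simp_all add: d_def ell_dist_def fnorm_def norm_minus_commute)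
  have d_nonneg: "0 \<le> d n" for n
    using diff[of n] by (simp add: d_eq fnorm_def ell_def suminf_nonneg)
  have d_lim: "d \<longlonglongrightarrow> 0"
    using lim by (simp add: d_def[abs_def])
  then have sqrt_lim: "(\<lambda>n. sqrt (d n)) \<longlonglongrightarrow> 0"
    using tendsto_real_sqrt by fastforce
  moreover have "(\<lambda>n. 1 / real (n + 2)) \<longlonglongrightarrow> 0"
    using LIMSEQ_ignore_initial_segment[OF lim_1_over_n, of 2] by simp
  ultimately have t_lim: "t \<longlonglongrightarrow> 0"
    unfolding t_def using tendsto_add by fastforce
  have t_pos: "0 < t n" for n
    using d_nonneg[of n] by (simp add: t_def add_nonneg_pos)
  \<comment> \<open>Since \<open>t n\<close> is at least \<open>sqrt (d n)\<close>, dividing by it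
    still leaves a null sequence.\<close>
  have dt: "d n / t n \<le> sqrt (d n)" for n
  proof -
    have "d n = sqrt (d n) * sqrt (d n)"
      using d_nonneg[of n] by simp
    also have "\<dots> \<le> sqrt (d n) * t n"
      using d_nonneg[of n] by (intro mult_left_mono) (auto simp: t_def)
    finally show ?thesis
      using t_pos[of n] by (simp add: field_simps)
  qed
  have t_lt_1: "eventually (\<lambda>n. t n < 1) sequentially"
    using order_tendstoD(2)[OF t_lim, of 1] by simp
  \<comment> \<open>The upper bound splits \<open>X n\<close> as \<open>x + (X n - x)\<close>; the
    lower bound below splits \<open>x\<close> as \<open>X n + (x - X n)\<close>.\<close>
  have "fnorm q (X n) \<le> fnorm q x / (1 - t n) + sqrt (d n)" if "t n < 1" for n
    using ell_add(2)[where q=q, OF q x diff[of n] t_pos that] dt[of n] by (simp add: d_eq(1))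
  then have upper: "eventually (\<lambda>n. fnorm q (X n) \<le> fnorm q x / (1 - t n) + sqrt (d n)) sequentially"
    using t_lt_1 by (rule eventually_mono[rotated])
  have "(fnorm q x - sqrt (d n)) * (1 - t n) \<le> fnorm q (X n)" if "t n < 1" for n
  proof -
    have "fnorm q x \<le> fnorm q (X n) / (1 - t n) + d n / t n"
      using ell_add(2)[where u="X n" and v="\<lambda>k. x k - X n k" and t="t n", OF q] X ell_uminus[OF diff[of n]] t_pos that
      by (simp add: d_eq(2))
    then have "fnorm q x - sqrt (d n) \<le> fnorm q (X n) / (1 - t n)"
      using dt[of n] by simp
    then show ?thesis
      using that by (simp add: pos_le_divide_eq)
  qed
  then have lower: "eventually (\<lambda>n. (fnorm q x - sqrt (d n)) * (1 - t n) \<le> fnorm q (X n)) sequentially"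
    using t_lt_1 by (rule eventually_mono[rotated])
  show "(\<lambda>n. fnorm q (X n)) \<longlonglongrightarrow> fnorm q x"
  proof (rule tendsto_sandwich[OF lower upper])
    have "(\<lambda>n. (fnorm q x - sqrt (d n)) * (1 - t n)) \<longlonglongrightarrow> (fnorm q x - 0) * (1 - 0)"
      by (intro tendsto_intros t_lim sqrt_lim)
    then show "(\<lambda>n. (fnorm q x - sqrt (d n)) * (1 - t n)) \<longlonglongrightarrow> fnorm q x"
      by simp
    have "(\<lambda>n. fnorm q x / (1 - t n) + sqrt (d n)) \<longlonglongrightarrow> fnorm q x / (1 - 0) + 0"
      by (intro tendsto_intros t_lim sqrt_lim) simp
    then show "(\<lambda>n. fnorm q x / (1 - t n) + sqrt (d n)) \<longlonglongrightarrow> fnorm q x"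
      by simp
  qed
qed

section \<open>Gateaux derivative on the space of absolutely summable sequences\<close>

lemma ell_1_closed:
  assumes "h \<in> ell (\<lambda>_. 1)"
  shows "h' \<in> ell (\<lambda>_. 1) \<Longrightarrow> (\<lambda>k. h k + h' k) \<in> ell (\<lambda>_. 1)"
    and "(\<lambda>k. c *\<^sub>R h k) \<in> ell (\<lambda>_. 1)"
proof -
  show "(\<lambda>k. h k + h' k) \<in> ell (\<lambda>_. 1)" if "h' \<in> ell (\<lambda>_. 1)"
    using summable_comparison_test'[where N=0 and f="\<lambda>k. norm (h k + h' k)" and g="\<lambda>k. norm (h k) + norm (h' k)"]
      assms that
    by (simp add: ell_1_iff norm_triangle_ineq summable_add)
  show "(\<lambda>k. c *\<^sub>R h k) \<in> ell (\<lambda>_. 1)"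
    using assms by (simp add: ell_1_iff summable_mult)
qed

lemma norm_fnorm_gradient_le:
  assumes q: "\<And>k. 1 < q k" "\<And>k. q k \<le> 2" and "norm (x k) \<le> R" "1 \<le> R"
  shows "norm (fnorm_gradient q x k) \<le> 2 * R"
proof -
  have "norm (fnorm_gradient q x k) \<le> q k * norm (x k) powr (q k - 1)"
    using q(1)[of k] by (simp add: fnorm_gradient_def norm_sgn)
  also have "\<dots> \<le> 2 * R"
    using assms by (intro mult_powr_minus_one_le) auto
  finally show ?thesis .
qed

lemma bounded_fnorm_gradient:
  assumes q: "\<And>k. 1 < q k" "\<And>k. q k \<le> 2" and x: "x \<in> ell (\<lambda>_. 1)"
  shows "bounded (range (fnorm_gradient q x))"
proof -
  have "norm (fnorm_gradient q x k) \<le> 2 * max 1 (l1_norm x)" for k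
    using norm_le_l1_norm[OF x, of k] by (intro norm_fnorm_gradient_le q) auto
  then show ?thesis
    by (auto simp: bounded_iff)
qed

text \<open>Termwise Cauchy-Schwarz: this is the pairing of bounded with absolutely summable
  sequences.\<close>

lemma summable_inner_bounded:
  fixes g h :: "nat \<Rightarrow> 'a::real_inner"
  assumes g: "\<And>k. norm (g k) \<le> C" and h: "h \<in> ell (\<lambda>_. 1)"
  shows "summable (\<lambda>k. inner (g k) (h k))"
    and "\<bar>\<Sum>k. inner (g k) (h k)\<bar> \<le> C * l1_norm h"
proof -
  have s: "summable (\<lambda>k. C * norm (h k))"
    using h by (simp add: ell_1_iff summable_mult)
  have le: "norm (inner (g k) (h k)) \<le> C * norm (h k)" for k
    using Cauchy_Schwarz_ineq2[of "g k" "h k"] mult_right_mono[OF g norm_ge_zero, of k "h k"] by simp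
  show "summable (\<lambda>k. inner (g k) (h k))"
    using le by (intro summable_comparison_test'[OF s]) auto
  have "norm (\<Sum>k. inner (g k) (h k)) \<le> (\<Sum>k. C * norm (h k))"
    by (rule norm_suminf_le[OF le s])
  also have "\<dots> = C * l1_norm h"
    using h by (simp add: ell_1_iff l1_norm_def suminf_mult)
  finally show "\<bar>\<Sum>k. inner (g k) (h k)\<bar> \<le> C * l1_norm h"
    by simp
qed

text \<open>\<open>L\<close> is only required to agree with the inner-product series on
  \<open>ell (\<lambda>_. 1)\<close>, so that both \<open>real_functional\<close> and
  \<open>complex_functional\<close> are covered.\<close>

lemma l1_bounded_linear_inner:
  fixes g :: "nat \<Rightarrow> 'a::real_inner"
  assumes "bounded (range g)"
    and L: "\<And>h. h \<in> ell (\<lambda>_. 1) \<Longrightarrow> L h = (\<Sum>k. inner (g k) (h k))"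
  shows "l1_bounded_linear L"
proof -
  obtain C where C: "\<And>k. norm (g k) \<le> C"
    using assms(1) by (auto simp: bounded_iff)
  have "L (\<lambda>k. h k + h' k) = L h + L h'" if "h \<in> ell (\<lambda>_. 1)" "h' \<in> ell (\<lambda>_. 1)" for h h'
    using that suminf_add[OF summable_inner_bounded(1)[where g=g, OF C that(1)] summable_inner_bounded(1)[where g=g, OF C that(2)]]
    by (simp add: L ell_1_closed inner_add_right)
  moreover have "L (\<lambda>k. c *\<^sub>R h k) = c * L h" if "h \<in> ell (\<lambda>_. 1)" for h c
    using that suminf_mult[OF summable_inner_bounded(1)[where g=g, OF C that]]
    by (simp add: L ell_1_closed)
  moreover have "\<exists>C. \<forall>h\<in>ell (\<lambda>_. 1). \<bar>L h\<bar> \<le> C * l1_norm h"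
  proof (intro exI ballI)
    fix h :: "nat \<Rightarrow> 'a"
    assume "h \<in> ell (\<lambda>_. 1)"
    then show "\<bar>L h\<bar> \<le> C * l1_norm h"
      using summable_inner_bounded(2)[where g=g, OF C] by (simp add: L)
  qed
  ultimately show ?thesis
    unfolding l1_bounded_linear_def by blast
qed

lemma fnorm_directional_derivative:
  fixes x h :: "nat \<Rightarrow> 'a::real_inner"
  assumes q: "\<And>k. 1 < q k" "\<And>k. q k \<le> 2" and x: "x \<in> ell (\<lambda>_. 1)" and h: "h \<in> ell (\<lambda>_. 1)"
  shows "((\<lambda>t::real. (fnorm q (\<lambda>k. x k + t *\<^sub>R h k) - fnorm q x) / t)
      \<longlongrightarrow> (\<Sum>k. inner (fnorm_gradient q x k) (h k))) (at 0)"
proof -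
  \<comment> \<open>\<open>R\<close> bounds the norms of \<open>x k\<close> and of
    \<open>x k + t *\<^sub>R h k\<close> for \<open>\<bar>t\<bar> < 1\<close>; the summand 1 secures
    \<open>1 \<le> R\<close>, which the Lipschitz bound requires.\<close>
  define R where "R = 1 + l1_norm x + l1_norm h"
  let ?a = "\<lambda>k t. (norm (x k + t *\<^sub>R h k) powr q k - norm (x k) powr q k) / t"
  have nonneg: "0 \<le> l1_norm x" "0 \<le> l1_norm h"
    using norm_le_l1_norm[OF x, of 0] norm_le_l1_norm[OF h, of 0] norm_ge_zero order_trans by blast+
  have bound: "norm (?a k t) \<le> 2 * R * norm (h k)" if "\<bar>t\<bar> < 1" for k t
  proof -
    have "norm (x k + t *\<^sub>R h k) \<le> norm (x k) + \<bar>t\<bar> * norm (h k)"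
      using norm_triangle_ineq[of "x k" "t *\<^sub>R h k"] by simp
    also have "\<dots> \<le> l1_norm x + 1 * l1_norm h"
      using that by (intro add_mono mult_mono norm_le_l1_norm x h) auto
    finally have "\<bar>norm (x k + t *\<^sub>R h k) powr q k - norm (x k) powr q k\<bar>
        \<le> 2 * R * \<bar>norm (x k + t *\<^sub>R h k) - norm (x k)\<bar>"
      using norm_le_l1_norm[OF x, of k] nonneg q by (intro abs_powr_diff_le) (auto simp: R_def)
    also have "\<dots> \<le> 2 * R * (\<bar>t\<bar> * norm (h k))"
      using norm_triangle_ineq3[of "x k + t *\<^sub>R h k" "x k"] nonneg
      by (intro mult_left_mono) (auto simp: R_def)
    \<comment> \<open>At \<open>t = 0\<close> the quotient is 0 by the convention for division by
      zero, so the bound holds there too.\<close>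
    finally show ?thesis
      using nonneg by (cases "t = 0") (auto simp: R_def field_simps)
  qed
  have ev: "eventually (\<lambda>(k, t). norm (?a k t) \<le> 2 * R * norm (h k)) (at_top \<times>\<^sub>F at (0::real))"
    unfolding eventually_prod_filter
  proof (intro exI conjI allI impI)
    show "eventually (\<lambda>_. True) (at_top :: nat filter)"
      by simp
    show "eventually (\<lambda>t. \<bar>t\<bar> < 1) (at (0::real))"
      by (auto simp: eventually_at intro: exI[of _ 1])
  qed (use bound in auto)
  have "((\<lambda>t. \<Sum>k. ?a k t) \<longlongrightarrow> (\<Sum>k. inner (fnorm_gradient q x k) (h k))) (at (0::real))"
    using norm_powr_line_deriv[OF q(1)] h
    by (intro tannerys_theorem[THEN conjunct2, THEN conjunct2, OF _ ev])
       (auto simp: fnorm_gradient_def ell_1_iff intro: summable_mult)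
  moreover have "(\<Sum>k. ?a k t) = (fnorm q (\<lambda>k. x k + t *\<^sub>R h k) - fnorm q x) / t" for t
  proof -
    have "(\<lambda>k. x k + t *\<^sub>R h k) \<in> ell q" "x \<in> ell q"
      using ell_1_subset_ell[where q=q, OF q(1)] ell_1_closed(1)[OF x ell_1_closed(2)[OF h]] x by blast+
    then show ?thesis
      by (simp add: ell_def fnorm_def suminf_divide suminf_diff summable_diff)
  qed
  ultimately show ?thesis
    by simp
qed

lemma fnorm_has_gateaux_derivative_l1:
  fixes x :: "nat \<Rightarrow> 'a::real_inner"
  assumes q: "\<And>k. 1 < q k" "\<And>k. q k \<le> 2" and x: "x \<in> ell (\<lambda>_. 1)"
    and L: "\<And>h. h \<in> ell (\<lambda>_. 1) \<Longrightarrow> L h = (\<Sum>k. inner (fnorm_gradient q x k) (h k))"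
  shows "has_gateaux_derivative_l1 (fnorm q) L x"
  unfolding has_gateaux_derivative_l1_def
  using l1_bounded_linear_inner[OF bounded_fnorm_gradient[where q=q, OF q x] L] L
    fnorm_directional_derivative[where q=q, OF q x]
  by simp

text \<open>The real part of \<open>g k * cnj (h k)\<close> is the real inner product on the complex
  plane. Summability, from boundedness of \<open>g\<close>, allows \<open>Re\<close> to be taken
  inside the series.\<close>

lemma complex_functional_eq_inner:
  assumes g: "bounded (range g)" and h: "h \<in> ell (\<lambda>_. 1)"
  shows "complex_functional g h = (\<Sum>k. inner (g k) (h k))"
proof -
  obtain C where C: "\<And>k. norm (g k) \<le> C"
    using g by (auto simp: bounded_iff)
  have "summable (\<lambda>k. g k * cnj (h k))"
  proof (rule summable_comparison_test')
    show "summable (\<lambda>k. C * norm (h k))"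
      using h by (simp add: ell_1_iff summable_mult)
    show "norm (g k * cnj (h k)) \<le> C * norm (h k)" for k
      using C[of k] by (simp add: norm_mult mult_right_mono)
  qed
  then show ?thesis
    by (simp add: complex_functional_def Re_suminf inner_complex_def)
qed

section \<open>Comparison with the 2-norm\<close>

lemma l2_norm_le_max_fnorm:
  assumes q: "\<And>k. 1 < q k" "\<And>k. q k \<le> 2" and x: "x \<in> ell q" and M: "fnorm q x \<le> M"
  shows "x \<in> ell (\<lambda>_. 2)" and "l2_norm x \<le> max M 1"
proof -
  have "0 \<le> q k" for k
    using q(1)[of k] by simp
  from ell_mono_eventually[OF x this, of "\<lambda>_. 2"] show "x \<in> ell (\<lambda>_. 2)"
    using q(2) by simp
  then have s2: "summable (\<lambda>k. (norm (x k))\<^sup>2)"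
    by (simp add: ell_def powr_numeral)
  define N where "N = max M 1"
  have N: "1 \<le> N" "M \<le> N"
    by (auto simp: N_def)
  let ?b = "\<lambda>k. norm (x k) powr q k / N"
  have s: "summable (\<lambda>k. norm (x k) powr q k)"
    using x by (simp add: ell_def)
  have sum_b: "(\<Sum>k. ?b k) \<le> 1"
    using s M N by (simp add: suminf_divide fnorm_def)
  \<comment> \<open>As \<open>N \<ge> 1\<close> and \<open>q k > 1\<close>, dividing by
    \<open>N\<close> inside the power gains at least the factor \<open>1 / N\<close>.\<close>
  have scaled: "(norm (x k) / N) powr q k \<le> ?b k" for k
    using powr_mono[of 1 "q k" N] q(1)[of k] N by (simp add: powr_divide frac_le)
  have "?b k \<le> 1" for k
  proof -
    have "sum ?b {k} \<le> (\<Sum>k. ?b k)"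
      using N by (intro sum_le_suminf summable_divide s) auto
    then show ?thesis
      using sum_b by simp
  qed
  then have "(norm (x k) / N) powr q k \<le> 1" for k
    using scaled order_trans by blast
  \<comment> \<open>A ratio above 1 would have a power above 1. Knowing it is at most 1 lets the
    exponent \<open>q k\<close> be raised to 2 below.\<close>
  then have le_1: "norm (x k) / N \<le> 1" for k
    using powr_less_mono2[of "q k" 1 "norm (x k) / N"] q(1)[of k] by (force simp: not_le[symmetric])
  have "(norm (x k))\<^sup>2 \<le> N\<^sup>2 * ?b k" for k
  proof -
    have "(norm (x k) / N)\<^sup>2 = (norm (x k) / N) powr 2"
      using N by (simp add: powr_numeral)
    also have "\<dots> \<le> (norm (x k) / N) powr q k"
      using N le_1 q(2) by (intro powr_mono') auto
    also have "\<dots> \<le> ?b k"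
      by (rule scaled)
    finally show ?thesis
      using N by (simp add: field_simps power2_eq_square)
  qed
  then have "(\<Sum>k. (norm (x k))\<^sup>2) \<le> (\<Sum>k. N\<^sup>2 * ?b k)"
    using s s2 by (intro suminf_le summable_mult summable_divide)
  also have "\<dots> = N\<^sup>2 * (\<Sum>k. ?b k)"
    using s by (intro suminf_mult summable_divide)
  also have "\<dots> \<le> N\<^sup>2"
    using mult_left_mono[OF sum_b, of "N\<^sup>2"] by simp
  finally have "l2_norm x \<le> N"
    unfolding l2_norm_def using N by (intro real_le_lsqrt) auto
  then show "l2_norm x \<le> max M 1"
    by (simp add: N_def)
qed

theorem proposition3p1:
  fixes q :: "nat \<Rightarrow> real"
  assumes q_gt_1: "\<And>k. 1 < q k"
    and q_le_2: "\<And>k. q k \<le> 2"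
    and q_tendsto: "q \<longlonglongrightarrow> 1"
  shows
    "(\<comment> \<open>real sequences\<close>
     \<comment> \<open>(i)\<close>
     ((ell (\<lambda>_. 1) :: (nat \<Rightarrow> real) set) \<subseteq> ell q \<and>
      (ell q :: (nat \<Rightarrow> real) set) \<subset> (\<Inter>p\<in>{1<..}. ell (\<lambda>_. p))) \<and>
     \<comment> \<open>(ii)\<close>
     (\<forall>x :: nat \<Rightarrow> real. x \<in> ell (\<lambda>_. 1) \<longrightarrow>
        fnorm q x \<le> (SUP k. l1_norm x powr q k) \<and>
        (l1_norm x \<le> 1 \<longrightarrow> fnorm q x \<le> l1_norm x)) \<and>
     \<comment> \<open>(iii)\<close>
     (strictly_convex_on (ell q) (fnorm q :: (nat \<Rightarrow> real) \<Rightarrow> real) \<and>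
      ell_continuous q (fnorm q :: (nat \<Rightarrow> real) \<Rightarrow> real)) \<and>
     \<comment> \<open>(iv)\<close>
     (\<forall>x :: nat \<Rightarrow> real. x \<in> ell (\<lambda>_. 1) \<longrightarrow>
        bounded (range (fnorm_gradient q x)) \<and>
        has_gateaux_derivative_l1 (fnorm q) (real_functional (fnorm_gradient q x)) x) \<and>
     \<comment> \<open>(v)\<close>
     (\<forall>(x :: nat \<Rightarrow> real) M. M > 0 \<and> x \<in> ell q \<and> fnorm q x \<le> M \<longrightarrow>
        x \<in> ell (\<lambda>_. 2) \<and> l2_norm x \<le> max M 1)) \<and>
     (\<comment> \<open>complex sequences\<close>
     \<comment> \<open>(i)\<close>
     ((ell (\<lambda>_. 1) :: (nat \<Rightarrow> complex) set) \<subseteq> ell q \<and>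
      (ell q :: (nat \<Rightarrow> complex) set) \<subset> (\<Inter>p\<in>{1<..}. ell (\<lambda>_. p))) \<and>
     \<comment> \<open>(ii)\<close>
     (\<forall>x :: nat \<Rightarrow> complex. x \<in> ell (\<lambda>_. 1) \<longrightarrow>
        fnorm q x \<le> (SUP k. l1_norm x powr q k) \<and>
        (l1_norm x \<le> 1 \<longrightarrow> fnorm q x \<le> l1_norm x)) \<and>
     \<comment> \<open>(iii)\<close>
     (strictly_convex_on (ell q) (fnorm q :: (nat \<Rightarrow> complex) \<Rightarrow> real) \<and>
      ell_continuous q (fnorm q :: (nat \<Rightarrow> complex) \<Rightarrow> real)) \<and>
     \<comment> \<open>(iv)\<close>
     (\<forall>x :: nat \<Rightarrow> complex. x \<in> ell (\<lambda>_. 1) \<longrightarrow>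
        bounded (range (fnorm_gradient q x)) \<and>
        has_gateaux_derivative_l1 (fnorm q) (complex_functional (fnorm_gradient q x)) x) \<and>
     \<comment> \<open>(v)\<close>
     (\<forall>(x :: nat \<Rightarrow> complex) M. M > 0 \<and> x \<in> ell q \<and> fnorm q x \<le> M \<longrightarrow>
        x \<in> ell (\<lambda>_. 2) \<and> l2_norm x \<le> max M 1))"
proof -
  have real: "real_functional (fnorm_gradient q x) h = (\<Sum>k. inner (fnorm_gradient q x k) (h k))"
    for x h :: "nat \<Rightarrow> real"
    by (simp add: real_functional_def)
  have complex: "complex_functional (fnorm_gradient q x) h = (\<Sum>k. inner (fnorm_gradient q x k) (h k))"
    if "x \<in> ell (\<lambda>_. 1)" "h \<in> ell (\<lambda>_. 1)" for x h :: "nat \<Rightarrow> complex"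
    using complex_functional_eq_inner bounded_fnorm_gradient[where q=q, OF q_gt_1 q_le_2] that by blast
  note q = q_gt_1 q_le_2
  note facts = ell_1_subset_ell[where q=q, OF q_gt_1]
    fnorm_le_SUP[where q=q, OF q] fnorm_le_l1_norm[where q=q, OF q]
    fnorm_strictly_convex[where q=q, OF q_gt_1] fnorm_continuous[where q=q, OF q]
    bounded_fnorm_gradient[where q=q, OF q] l2_norm_le_max_fnorm[where q=q, OF q]
  show ?thesis
    \<comment> \<open>The number 1 serves in both fields as the unit vector carrying the
      counterexample for strictness.\<close>
    using ell_strict_subset[where q=q, OF q_gt_1 q_tendsto, of "1::real"]
      ell_strict_subset[where q=q, OF q_gt_1 q_tendsto, of "1::complex"]
    by (intro conjI allI impI; (elim conjE)?)
      (simp_all add: facts fnorm_has_gateaux_derivative_l1[where q=q, OF q] real complex)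
qed

end
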